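(* Let $X\subset\mathbb{R}^n$ be a finite set, let $f\colon X\to\{-1,1\}$ and $F\colon\{-1,1\}^k\to\{-1,1\}$ be given functions. Then for every $0<\epsilon<1$, \[\deg_{\epsilon}(F(f,\dots,f))\geq \deg_{\epsilon}(F)\,\deg_{\pm}(f).\]
   Context: For a function $h\colon Z\to\{-1,1\}$ on a finite set $Z\subset\mathbb{R}^m$: the $\epsilon$-approximate degree $\deg_\epsilon(h)$ is the least total degree of a real polynomial $p$ with $|h(z)-p(z)|\leq\epsilon$ for all $z\in Z$; the threshold degree $\deg_{\pm}(h)$ is the least total degree of a real polynomial $p$ with $h(z)p(z)>0$ for all $z\in Z$. The composition $F(f,\dots,f)$ is the function on $X^k\subset\mathbb{R}^{nk}$ given by $(x_1,\dots,x_k)\mapsto F(f(x_1),\dots,f(x_k))$. *)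

theory Defs
  imports "HOL-Analysis.Analysis" "HOL-Library.Poly_Mapping"
begin

text \<open>
  A real polynomial in variables indexed by \<open>'v\<close> is a finitely supported map from exponent
  vectors to coefficients.
\<close>
type_synonym 'v rpoly = "('v \<Rightarrow>\<^sub>0 nat) \<Rightarrow>\<^sub>0 real"

definition poly_eval :: "('v::finite) rpoly \<Rightarrow> real ^ 'v \<Rightarrow> real" where
  "poly_eval p z =
     (\<Sum>m\<in>Poly_Mapping.keys p. Poly_Mapping.lookup p m * (\<Prod>i\<in>UNIV. (z $ i) ^ Poly_Mapping.lookup m i))"

text \<open>The zero polynomial is given degree \<open>0\<close>.\<close>
definition total_degree :: "('v::finite) rpoly \<Rightarrow> nat" where
  "total_degree p = Max (insert 0 ((\<lambda>m. \<Sum>i\<in>UNIV. Poly_Mapping.lookup m i) ` Poly_Mapping.keys p))"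

text \<open>
  A function on a finite set \<open>Z\<close> is represented by a total function, of which only the values
  on \<open>Z\<close> matter.  On a finite \<open>Z\<close>, interpolation shows that both minima below range over
  nonempty sets whenever \<open>\<epsilon> \<ge> 0\<close> and \<open>h\<close> takes values in \<open>{-1, 1}\<close> on \<open>Z\<close>.
\<close>
definition approx_degree :: "real \<Rightarrow> (real ^ 'v::finite) set \<Rightarrow> (real ^ 'v \<Rightarrow> real) \<Rightarrow> nat" where
  "approx_degree \<epsilon> Z h =
     (LEAST d. \<exists>p. total_degree p = d \<and> (\<forall>z\<in>Z. \<bar>h z - poly_eval p z\<bar> \<le> \<epsilon>))"

definition threshold_degree :: "(real ^ 'v::finite) set \<Rightarrow> (real ^ 'v \<Rightarrow> real) \<Rightarrow> nat" where
  "threshold_degree Z h =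
     (LEAST d. \<exists>p. total_degree p = d \<and> (\<forall>z\<in>Z. h z * poly_eval p z > 0))"

definition sign_cube :: "(real ^ 'k::finite) set" where
  "sign_cube = {y. \<forall>i. y $ i \<in> {-1, 1}}"

text \<open>
  Points of \<open>(\<real>\<^sup>n)\<^sup>k = \<real>\<^sup>n\<^sup>k\<close> are vectors with index type \<open>'k \<times> 'n\<close>.
\<close>
definition block :: "real ^ ('k::finite \<times> 'n::finite) \<Rightarrow> 'k \<Rightarrow> real ^ 'n" where
  "block z i = (\<chi> j. z $ (i, j))"

definition set_power :: "(real ^ 'n::finite) set \<Rightarrow> (real ^ ('k::finite \<times> 'n)) set" where
  "set_power X = {z. \<forall>i. block z i \<in> X}"

definition block_compose ::
    "(real ^ 'k::finite \<Rightarrow> real) \<Rightarrow> (real ^ 'n::finite \<Rightarrow> real) \<Rightarrow> real ^ ('k \<times> 'n) \<Rightarrow> real" where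
  "block_compose F f z = F (\<chi> i. f (block z i))"

end

theory Submission
  imports Defs
begin

text \<open>
  Let \<open>D\<close> be the threshold degree of \<open>f\<close>. By linear programming duality there is a probability
  distribution \<open>w\<close> on \<open>X\<close> under which \<open>f\<close> is orthogonal to every polynomial of degree less
  than \<open>D\<close>. Given an approximant \<open>p\<close> of the composition, let \<open>q y\<close> be the expectation of
  \<open>p (x\<^sub>1, \<dots>, x\<^sub>k)\<close> for independent \<open>x\<^sub>i\<close> drawn from \<open>w\<close> conditioned on \<open>f x\<^sub>i = y\<^sub>i\<close>, that is, with
  density \<open>w x\<^sub>i * (1 + y\<^sub>i * f x\<^sub>i)\<close>. Then \<open>q\<close> approximates \<open>F\<close> at least as well as \<open>p\<close> does the
  composition. In the expectation of a monomial of \<open>p\<close> the variable \<open>y\<^sub>i\<close> survives only if the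
  monomial has degree at least \<open>D\<close> in \<open>x\<^sub>i\<close>, whence \<open>deg q * D \<le> deg p\<close>.
\<close>

section \<open>Polynomial functions of bounded degree\<close>

text \<open>The degree is only bounded and the formal polynomial is forgotten: cancellation in sums
  needs no care, and degree bounds follow from closure rules.\<close>

definition poly_fun :: "nat \<Rightarrow> (real ^ 'v::finite \<Rightarrow> real) \<Rightarrow> bool" where
  "poly_fun d g \<longleftrightarrow> (\<exists>p. total_degree p \<le> d \<and> poly_eval p = g)"

lemma total_degree_le_iff:
  "total_degree p \<le> d \<longleftrightarrow>
     (\<forall>m\<in>Poly_Mapping.keys p. (\<Sum>i\<in>UNIV. Poly_Mapping.lookup m i) \<le> d)"
  unfolding total_degree_def by (subst Max_le_iff) auto

lemma poly_eval_superset: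
  assumes "finite M" "Poly_Mapping.keys p \<subseteq> M"
  shows "poly_eval p z =
    (\<Sum>m\<in>M. Poly_Mapping.lookup p m * (\<Prod>i\<in>UNIV. (z $ i) ^ Poly_Mapping.lookup m i))"
  unfolding poly_eval_def using assms
  by (intro sum.mono_neutral_left) (auto simp: in_keys_iff)

lemma poly_fun_mono: "poly_fun d g \<Longrightarrow> d \<le> e \<Longrightarrow> poly_fun e g"
  unfolding poly_fun_def by (auto intro: order_trans)

lemma poly_fun_monomial:
  "poly_fun (\<Sum>i\<in>UNIV. Poly_Mapping.lookup m i)
     (\<lambda>z. c * (\<Prod>i\<in>UNIV. (z $ i) ^ Poly_Mapping.lookup m i))"
  unfolding poly_fun_def
proof (intro exI conjI)
  show "total_degree (Poly_Mapping.single m c) \<le> (\<Sum>i\<in>UNIV. Poly_Mapping.lookup m i)"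
    by (auto simp: total_degree_le_iff split: if_splits)
  show "poly_eval (Poly_Mapping.single m c) =
      (\<lambda>z. c * (\<Prod>i\<in>UNIV. (z $ i) ^ Poly_Mapping.lookup m i))"
    by (rule ext, subst poly_eval_superset[of "{m}"]) auto
qed

lemma poly_fun_const: "poly_fun d (\<lambda>z. c)"
  using poly_fun_mono[OF poly_fun_monomial[of 0 c], of d] by simp

lemma poly_fun_component: "poly_fun 1 (\<lambda>z. z $ i)"
proof -
  have "(\<Prod>j\<in>UNIV. (z $ j) ^ Poly_Mapping.lookup (Poly_Mapping.single i 1) j) = z $ i"
    for z :: "real ^ 'a"
    by (subst prod.mono_neutral_right[of UNIV "{i}"]) (auto simp: lookup_single when_def)
  moreover have "(\<Sum>j\<in>UNIV. Poly_Mapping.lookup (Poly_Mapping.single i (1::nat)) j) = 1"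
    by (simp add: lookup_single when_def)
  ultimately show ?thesis
    using poly_fun_monomial[of "Poly_Mapping.single i 1" 1] by simp
qed

lemma poly_fun_add:
  assumes "poly_fun d g" "poly_fun d h"
  shows "poly_fun d (\<lambda>z. g z + h z)"
proof -
  obtain p q where p: "total_degree p \<le> d" "poly_eval p = g"
    and q: "total_degree q \<le> d" "poly_eval q = h"
    using assms unfolding poly_fun_def by blast
  have sub: "Poly_Mapping.keys (p + q) \<subseteq> Poly_Mapping.keys p \<union> Poly_Mapping.keys q"
    by (rule Poly_Mapping.keys_add)
  have "total_degree (p + q) \<le> d"
    using p(1) q(1) sub unfolding total_degree_le_iff by blast
  moreover have "poly_eval (p + q) z = g z + h z" for z
    unfolding p(2)[symmetric] q(2)[symmetric]
    by (simp add: poly_eval_superset[of "Poly_Mapping.keys p \<union> Poly_Mapping.keys q"] sub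
        lookup_add distrib_right sum.distrib)
  ultimately show ?thesis
    unfolding poly_fun_def by blast
qed

lemma poly_fun_sum:
  "(\<And>a. a \<in> A \<Longrightarrow> poly_fun d (g a)) \<Longrightarrow> poly_fun d (\<lambda>z. \<Sum>a\<in>A. g a z)"
  by (induction A rule: infinite_finite_induct) (auto intro: poly_fun_const poly_fun_add)

text \<open>Expanding both factors gives monomials with exponents \<open>m + m'\<close>, so the
  coefficients of the product polynomial are never computed.\<close>

lemma poly_fun_mult:
  assumes "poly_fun d g" "poly_fun e h"
  shows "poly_fun (d + e) (\<lambda>z. g z * h z)"
proof -
  obtain p q where p: "total_degree p \<le> d" "poly_eval p = g"
    and q: "total_degree q \<le> e" "poly_eval q = h"
    using assms unfolding poly_fun_def by blast
  let ?mon = "\<lambda>m z. \<Prod>i\<in>UNIV. (z $ i) ^ Poly_Mapping.lookup m i"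
  have "(\<lambda>z. g z * h z) = (\<lambda>z. \<Sum>m\<in>Poly_Mapping.keys p. \<Sum>m'\<in>Poly_Mapping.keys q.
      (Poly_Mapping.lookup p m * Poly_Mapping.lookup q m') * ?mon (m + m') z)"
    unfolding p(2)[symmetric] q(2)[symmetric] poly_eval_def
    by (simp add: sum_product lookup_add power_add prod.distrib mult_ac)
  moreover have "poly_fun (d + e) \<dots>"
  proof (intro poly_fun_sum)
    fix m m' assume "m \<in> Poly_Mapping.keys p" "m' \<in> Poly_Mapping.keys q"
    then have "(\<Sum>i\<in>UNIV. Poly_Mapping.lookup (m + m') i) \<le> d + e"
      using p(1) q(1) by (auto simp: total_degree_le_iff lookup_add sum.distrib intro: add_mono)
    then show "poly_fun (d + e)
        (\<lambda>z. (Poly_Mapping.lookup p m * Poly_Mapping.lookup q m') * ?mon (m + m') z)"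
      using poly_fun_monomial poly_fun_mono by blast
  qed
  ultimately show ?thesis by simp
qed

lemma poly_fun_cmult: "poly_fun d g \<Longrightarrow> poly_fun d (\<lambda>z. c * g z)"
  using poly_fun_mult[OF poly_fun_const[of 0 c], of d g] by simp

lemma poly_fun_prod:
  "(\<And>a. a \<in> A \<Longrightarrow> poly_fun (d a) (g a)) \<Longrightarrow> poly_fun (\<Sum>a\<in>A. d a) (\<lambda>z. \<Prod>a\<in>A. g a z)"
  by (induction A rule: infinite_finite_induct) (auto intro: poly_fun_const poly_fun_mult)

lemma poly_fun_power: "poly_fun d g \<Longrightarrow> poly_fun (n * d) (\<lambda>z. g z ^ n)"
  using poly_fun_prod[of "{..<n}" "\<lambda>_. d" "\<lambda>_. g"] by simp

text \<open>Lagrange interpolation: \<open>b w\<close> is the product of squared distances to the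
  other points of \<open>Z\<close>, so on \<open>Z\<close> it vanishes except at \<open>w\<close>.
  This makes the minimum in \<open>approx_degree\<close> attained; the size of the degree is
  immaterial.\<close>

lemma poly_fun_interpolation:
  fixes h :: "real ^ 'v::finite \<Rightarrow> real"
  assumes "finite Z"
  shows "\<exists>d g. poly_fun d g \<and> (\<forall>z\<in>Z. g z = h z)"
proof -
  define b :: "real ^ 'v \<Rightarrow> real ^ 'v \<Rightarrow> real"
    where "b w z = (\<Prod>v\<in>Z - {w}. \<Sum>i\<in>UNIV. (z $ i + - v $ i) ^ 2)" for w z
  have "poly_fun (\<Sum>v\<in>Z - {w}. 2 * 1) (b w)" for w
    unfolding b_def
    by (intro poly_fun_prod poly_fun_sum poly_fun_power poly_fun_add poly_fun_component
        poly_fun_const)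
  then have "poly_fun (2 * card Z) (b w)" for w
    by (rule poly_fun_mono) (simp add: assms card_Diff1_le)
  then have "poly_fun (2 * card Z) (\<lambda>z. \<Sum>w\<in>Z. (h w / b w w) * b w z)"
    by (intro poly_fun_sum poly_fun_cmult)
  moreover have "(\<Sum>w\<in>Z. (h w / b w w) * b w z) = h z" if "z \<in> Z" for z
  proof -
    have "b w z = 0" if "w \<noteq> z" for w
      unfolding b_def using that \<open>z \<in> Z\<close> assms by (intro prod_zero bexI[of _ z]) auto
    moreover have "b z z \<noteq> 0"
      using assms by (auto simp: b_def sum_nonneg_eq_0_iff vec_eq_iff)
    ultimately show ?thesis
      using that assms by (subst sum.mono_neutral_right[of Z "{z}"]) auto
  qed
  ultimately show ?thesis by blast
qed

section \<open>The two degrees as minima over polynomial functions\<close>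

lemma approx_degree_le:
  assumes "poly_fun d g" "\<And>z. z \<in> Z \<Longrightarrow> \<bar>h z - g z\<bar> \<le> \<epsilon>"
  shows "approx_degree \<epsilon> Z h \<le> d"
proof -
  obtain p where p: "total_degree p \<le> d" "poly_eval p = g"
    using assms(1) unfolding poly_fun_def by blast
  have "approx_degree \<epsilon> Z h \<le> total_degree p"
    unfolding approx_degree_def by (rule Least_le) (use p assms(2) in auto)
  then show ?thesis using p by simp
qed

lemma approx_degree_attained:
  assumes "finite Z" "0 \<le> \<epsilon>"
  obtains p where "total_degree p = approx_degree \<epsilon> Z h"
    "\<And>z. z \<in> Z \<Longrightarrow> \<bar>h z - poly_eval p z\<bar> \<le> \<epsilon>"
proof -
  obtain p where "\<forall>z\<in>Z. poly_eval p z = h z"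
    using poly_fun_interpolation[OF assms(1), of h] unfolding poly_fun_def by metis
  then have "\<exists>d p. total_degree p = d \<and> (\<forall>z\<in>Z. \<bar>h z - poly_eval p z\<bar> \<le> \<epsilon>)"
    using assms(2) by (intro exI[of _ "total_degree p"] exI[of _ p]) auto
  from LeastI_ex[OF this] show ?thesis
    using that unfolding approx_degree_def by blast
qed

lemma poly_fun_below_threshold:
  assumes "poly_fun d g" "d < threshold_degree Z h"
  shows "\<exists>z\<in>Z. h z * g z \<le> 0"
proof (rule ccontr)
  assume neg: "\<not> ?thesis"
  obtain p where p: "total_degree p \<le> d" "poly_eval p = g"
    using assms(1) unfolding poly_fun_def by blast
  have "threshold_degree Z h \<le> total_degree p"
    unfolding threshold_degree_def by (rule Least_le) (use p neg in force)
  then show False using p assms(2) by simp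
qed

section \<open>Gordan's theorem of the alternative\<close>

lemma small_perturbation_pos:
  fixes g h :: "'a \<Rightarrow> real"
  assumes "finite X" "\<And>x. x \<in> X \<Longrightarrow> 0 < g x"
  shows "\<exists>\<delta>>0. \<forall>x\<in>X. 0 < g x + \<delta> * h x"
  using assms
proof (induction X rule: finite_induct)
  case empty
  show ?case by (auto intro: exI[of _ 1])
next
  case (insert a X)
  then obtain \<delta> where \<delta>: "\<delta> > 0" "\<forall>x\<in>X. 0 < g x + \<delta> * h x" by auto
  \<comment> \<open>The \<open>+ 1\<close> keeps the denominator nonzero and yields
    \<open>\<eta> * |h a| + \<eta> \<le> g a\<close>, hence strict positivity at
    \<open>a\<close>.\<close>
  define \<eta> where "\<eta> = min \<delta> (g a / (\<bar>h a\<bar> + 1))"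
  have ga: "0 < g a" using insert by auto
  have \<eta>: "0 < \<eta>" "\<eta> \<le> \<delta>" "\<eta> \<le> g a / (\<bar>h a\<bar> + 1)"
    using \<delta> ga by (auto simp: \<eta>_def)
  have "0 < g x + \<eta> * h x" if "x \<in> X" for x
  proof (cases "h x \<ge> 0")
    case True
    then show ?thesis using that insert.prems \<eta>(1) by (simp add: add_pos_nonneg)
  next
    case False
    then have "\<delta> * h x \<le> \<eta> * h x" using \<eta>(2) by (intro mult_right_mono_neg) auto
    then show ?thesis using \<delta>(2) that by force
  qed
  moreover have "0 < g a + \<eta> * h a"
  proof -
    have "\<eta> * \<bar>h a\<bar> + \<eta> \<le> g a" using \<eta>(3) by (simp add: field_simps)
    moreover have "- (\<eta> * h a) \<le> \<eta> * \<bar>h a\<bar>" using \<eta>(1) by (simp add: abs_if)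
    ultimately show ?thesis using \<eta>(1) by linarith
  qed
  ultimately show ?case using \<eta>(1) by auto
qed

text \<open>Eliminating one point \<open>a\<close> at a time, via the subspace of functions vanishing at \<open>a\<close>, avoids
  separating hyperplanes and hence a Euclidean space indexed by \<open>X\<close>.\<close>

lemma gordan_alternative:
  fixes V :: "('a \<Rightarrow> real) set"
  assumes "finite X"
    and "\<And>g h. g \<in> V \<Longrightarrow> h \<in> V \<Longrightarrow> (\<lambda>x. g x + h x) \<in> V"
    and "\<And>c g. g \<in> V \<Longrightarrow> (\<lambda>x. c * g x) \<in> V"
    and "V \<noteq> {}"
    and "\<And>g. g \<in> V \<Longrightarrow> \<exists>x\<in>X. g x \<le> 0"
  shows "\<exists>w. (\<forall>x\<in>X. 0 \<le> w x) \<and> (\<Sum>x\<in>X. w x) = (1::real) \<and> (\<forall>g\<in>V. (\<Sum>x\<in>X. w x * g x) = 0)"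
  using assms
proof (induction X arbitrary: V rule: finite_induct)
  case empty
  then show ?case by auto
next
  case (insert a X V)
  note add = insert.prems(1) and scale = insert.prems(2) and nonempty = insert.prems(3)
    and nonpos = insert.prems(4)
  have sum_upd: "(\<Sum>x\<in>insert a X. (w(a := c)) x * g x) = c * g a + (\<Sum>x\<in>X. w x * g x)"
    for w g :: "'a \<Rightarrow> real" and c
    using insert.hyps by (simp, intro sum.cong) auto
  show ?case
  proof (cases "\<forall>g\<in>V. \<exists>x\<in>X. g x \<le> 0")
    \<comment> \<open>Nothing in \<open>V\<close> is positive on all of \<open>X\<close>, so the
      weights for \<open>X\<close> serve, with weight 0 at \<open>a\<close>.\<close>
    case True
    with insert.IH[of V] add scale nonempty obtain w where
      w: "\<forall>x\<in>X. 0 \<le> w x" "(\<Sum>x\<in>X. w x) = 1" "\<forall>g\<in>V. (\<Sum>x\<in>X. w x * g x) = 0"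
      by blast
    show ?thesis
      by (rule exI[of _ "w(a := 0)"]) (use w sum_upd[of w 0] sum_upd[of w 0 "\<lambda>_. 1"] in auto)
  next
    case False
    then obtain g where g: "g \<in> V" "\<And>x. x \<in> X \<Longrightarrow> 0 < g x" by force
    then have ga: "g a \<le> 0" using nonpos by force
    \<comment> \<open>If \<open>h a\<close> were positive, a small multiple of \<open>h\<close>
      added to \<open>u\<close> would keep it positive on \<open>X\<close> and make it positive at
      \<open>a\<close>, against \<open>nonpos\<close>.\<close>
    have vanish: "h a = 0" if h: "h \<in> V" "0 \<le> h a"
      and u: "u \<in> V" "u a = 0" "\<And>x. x \<in> X \<Longrightarrow> 0 < u x" for h u
    proof (rule ccontr)
      assume "h a \<noteq> 0"
      then have "0 < h a" using h by simp
      obtain \<delta> where \<delta>: "\<delta> > 0" "\<forall>x\<in>X. 0 < u x + \<delta> * h x"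
        using small_perturbation_pos[of X u h] insert.hyps(1) u(3) by blast
      have "(\<lambda>x. u x + \<delta> * h x) \<in> V" using add[OF u(1) scale[OF h(1)]] .
      from nonpos[OF this] show False
        using \<delta>(2) u(2) mult_pos_pos[OF \<delta>(1) \<open>0 < h a\<close>]
        by (metis add_0 insert_iff linorder_not_less)
    qed
    show ?thesis
    proof (cases "g a = 0")
      \<comment> \<open>Here \<open>g\<close> itself can play \<open>u\<close>; applying
        \<open>vanish\<close> to \<open>h\<close> and \<open>- h\<close> shows that the point mass
        at \<open>a\<close> is a solution.\<close>
      case True
      have "h a = 0" if "h \<in> V" for h
        using vanish[OF that _ g(1) True g(2)]
          vanish[OF scale[OF that, of "-1"] _ g(1) True g(2)] by fastforce
      then show ?thesis
        by (intro exI[of _ "(\<lambda>_. 0)(a := 1)"])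
          (use sum_upd[of "\<lambda>_. 0" 1] sum_upd[of "\<lambda>_. 0" 1 "\<lambda>_. 1"] in auto)
    next
      case False
      with ga have ga': "g a < 0" by simp
      let ?V = "{h \<in> V. h a = 0}"
      \<comment> \<open>A function of \<open>?V\<close> positive on \<open>X\<close> would, by
        \<open>vanish\<close> for \<open>- g\<close>, force \<open>g a = 0\<close>.\<close>
      have "\<exists>x\<in>X. u x \<le> 0" if u: "u \<in> ?V" for u
      proof (rule ccontr)
        assume "\<not> ?thesis"
        then have "\<And>x. x \<in> X \<Longrightarrow> 0 < u x" by force
        then have "- 1 * g a = 0"
          using vanish[OF scale[OF g(1), of "-1"], of u] u ga' by auto
        then show False using ga' by simp
      qed
      moreover have "?V \<noteq> {}" using scale[OF g(1), of 0] by auto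
      ultimately have "\<exists>w. (\<forall>x\<in>X. 0 \<le> w x) \<and> (\<Sum>x\<in>X. w x) = (1::real) \<and>
          (\<forall>g\<in>?V. (\<Sum>x\<in>X. w x * g x) = 0)"
        by (intro insert.IH) (auto intro: add scale)
      then obtain w where
        w: "\<forall>x\<in>X. 0 \<le> w x" "(\<Sum>x\<in>X. w x) = 1" "\<forall>g\<in>?V. (\<Sum>x\<in>X. w x * g x) = 0"
        by blast
      define s where "s = (\<Sum>x\<in>X. w x * g x)"
      \<comment> \<open>This weight makes \<open>c * g a + s = 0\<close>, so that \<open>g\<close>
        is annihilated; it is nonnegative since \<open>g a < 0 \<le> s\<close>.\<close>
      define c where "c = s / - g a"
      have "0 \<le> s" unfolding s_def using w g(2) by (intro sum_nonneg) (simp add: less_imp_le)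
      then have c: "0 \<le> c" using ga' by (simp add: c_def divide_nonneg_neg)
      have annihilate: "c * h a + (\<Sum>x\<in>X. w x * h x) = 0" if "h \<in> V" for h
      proof -
        \<comment> \<open>Subtracting the multiple of \<open>g\<close> that agrees with
          \<open>h\<close> at \<open>a\<close> lands in \<open>?V\<close>, so annihilating
          \<open>?V\<close> and \<open>g\<close> suffices.\<close>
        have "(\<lambda>x. h x + (- h a / g a) * g x) \<in> V" using add[OF that scale[OF g(1)]] .
        then have "(\<Sum>x\<in>X. w x * (h x + (- h a / g a) * g x)) = 0"
          using w(3) ga' by auto
        also have "(\<Sum>x\<in>X. w x * (h x + (- h a / g a) * g x)) =
            (\<Sum>x\<in>X. w x * h x) + (- h a / g a) * s"
          unfolding s_def sum_distrib_left sum.distrib[symmetric]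
          by (intro sum.cong refl) (simp add: algebra_simps)
        finally show ?thesis using ga' by (simp add: c_def field_simps)
      qed
      \<comment> \<open>\<open>c + 1\<close> is the total mass of the extended weights.\<close>
      define W where "W x = (w(a := c)) x / (c + 1)" for x
      have sum_W: "(\<Sum>x\<in>insert a X. W x * h x) = (c * h a + (\<Sum>x\<in>X. w x * h x)) / (c + 1)"
        for h
        unfolding sum_upd[symmetric] W_def by (simp add: sum_divide_distrib)
      show ?thesis
        by (rule exI[of _ W])
          (use w c annihilate sum_W sum_W[of "\<lambda>_. 1"] in \<open>auto simp: W_def\<close>)
    qed
  qed
qed

section \<open>The composition bound\<close>

text \<open>Gordan's alternative is applied to the products of \<open>f\<close> with polynomials of
  degree at most \<open>D - 1\<close>; minimality of the threshold degree \<open>D\<close> says that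
  none is positive on all of \<open>X\<close>. Positivity of \<open>D\<close> makes
  \<open>d < D\<close> the same as \<open>d \<le> D - 1\<close> under natural subtraction.\<close>

lemma threshold_degree_dual:
  fixes X :: "(real ^ 'n::finite) set"
  assumes "finite X" "0 < threshold_degree X f"
  obtains w where "\<And>x. x \<in> X \<Longrightarrow> 0 \<le> w x" "(\<Sum>x\<in>X. w x) = 1"
    "\<And>d g. poly_fun d g \<Longrightarrow> d < threshold_degree X f \<Longrightarrow> (\<Sum>x\<in>X. w x * (f x * g x)) = 0"
proof -
  define D where "D = threshold_degree X f"
  define V where "V = {\<lambda>x. f x * g x | g. poly_fun (D - 1) g}"
  have V_I: "(\<lambda>x. f x * g x) \<in> V" if "poly_fun (D - 1) g" for g
    using that unfolding V_def by blast
  have "\<exists>w. (\<forall>x\<in>X. 0 \<le> w x) \<and> (\<Sum>x\<in>X. w x) = (1::real) \<and> (\<forall>g\<in>V. (\<Sum>x\<in>X. w x * g x) = 0)"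
  proof (rule gordan_alternative[OF assms(1)])
    show "(\<lambda>x. g x + h x) \<in> V" if gh: "g \<in> V" "h \<in> V" for g h
    proof -
      obtain g' h' where "g = (\<lambda>x. f x * g' x)" "poly_fun (D - 1) g'"
        "h = (\<lambda>x. f x * h' x)" "poly_fun (D - 1) h'"
        using gh unfolding V_def by blast
      then show ?thesis
        using V_I[OF poly_fun_add, of g' h'] by (simp add: distrib_left)
    qed
    show "(\<lambda>x. c * g x) \<in> V" if g: "g \<in> V" for c g
    proof -
      obtain g' where "g = (\<lambda>x. f x * g' x)" "poly_fun (D - 1) g'"
        using g unfolding V_def by blast
      then show ?thesis
        using V_I[OF poly_fun_cmult, of g' c] by (simp add: mult_ac)
    qed
    show "V \<noteq> {}" using V_I[OF poly_fun_const] by blast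
    show "\<exists>x\<in>X. g x \<le> 0" if "g \<in> V" for g
      using that poly_fun_below_threshold[of "D - 1" _ X f] assms(2)
      unfolding V_def D_def by fastforce
  qed
  then obtain w where w: "\<forall>x\<in>X. 0 \<le> w x" "(\<Sum>x\<in>X. w x) = 1"
    "\<forall>g\<in>V. (\<Sum>x\<in>X. w x * g x) = 0" by blast
  show ?thesis
  proof
    show "(\<Sum>x\<in>X. w x * (f x * g x)) = 0"
      if "poly_fun d g" "d < threshold_degree X f" for d g
      using w(3) V_I[OF poly_fun_mono[OF that(1)]] that(2) by (simp add: D_def)
  qed (use w in auto)
qed

text \<open>Inverse of \<open>block\<close>: points of \<open>set_power X\<close> become families of
  points of \<open>X\<close>, over which sums of products factorise.\<close>

definition unblock :: "('k::finite \<Rightarrow> real ^ 'n::finite) \<Rightarrow> real ^ ('k \<times> 'n)" where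
  "unblock g = (\<chi> ij. g (fst ij) $ snd ij)"

lemma block_unblock [simp]: "block (unblock g) i = g i"
  by (simp add: block_def unblock_def vec_eq_iff)

lemma unblock_block [simp]: "unblock (block z) = z"
  by (simp add: block_def unblock_def vec_eq_iff)

lemma finite_set_power:
  fixes X :: "(real ^ 'n::finite) set"
  assumes "finite X"
  shows "finite (set_power X :: (real ^ ('k::finite \<times> 'n)) set)"
proof (rule finite_subset)
  show "set_power X \<subseteq> unblock ` ((UNIV :: 'k set) \<rightarrow>\<^sub>E X)"
  proof
    fix z :: "real ^ ('k \<times> 'n)" assume "z \<in> set_power X"
    then have "block z \<in> UNIV \<rightarrow>\<^sub>E X" by (auto simp: set_power_def)
    then show "z \<in> unblock ` (UNIV \<rightarrow>\<^sub>E X)" by (metis image_eqI unblock_block)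
  qed
qed (simp add: finite_PiE assms)

text \<open>The threshold degree matters only through its dual weights, so any \<open>D\<close> and
  \<open>w\<close> with the orthogonality are allowed here.\<close>

lemma approx_degree_compose_ge_of_dual:
  fixes X :: "(real ^ 'n::finite) set"
    and f :: "real ^ 'n \<Rightarrow> real"
    and F :: "real ^ 'k::finite \<Rightarrow> real"
  assumes X: "finite X" and f: "f \<in> X \<rightarrow> {-1, 1}" and eps: "0 \<le> \<epsilon>"
    and D: "0 < D"
    and w: "\<And>x. x \<in> X \<Longrightarrow> 0 \<le> w x" "(\<Sum>x\<in>X. w x) = 1"
    and orth: "\<And>d g. poly_fun d g \<Longrightarrow> d < D \<Longrightarrow> (\<Sum>x\<in>X. w x * (f x * g x)) = 0"
  shows "approx_degree \<epsilon> sign_cube F * D \<le> approx_degree \<epsilon> (set_power X) (block_compose F f)"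
proof -
  let ?L = "approx_degree \<epsilon> (set_power X) (block_compose F f)"
  obtain p where p: "total_degree p = ?L"
    "\<And>z. z \<in> set_power X \<Longrightarrow> \<bar>block_compose F f z - poly_eval p z\<bar> \<le> \<epsilon>"
    using approx_degree_attained[OF finite_set_power[OF X] eps] by blast
  define G :: "('k \<Rightarrow> real ^ 'n) set" where "G = UNIV \<rightarrow>\<^sub>E X"
  \<comment> \<open>Orthogonality to constants gives each sign of \<open>f\<close> mass 1/2, so for
    \<open>y\<close> in the cube the factor \<open>1 + y $ i * f (g i)\<close>, which is 2 or 0, is
    exactly the conditioning on \<open>f (g i) = y $ i\<close>. As a formula it is affine in
    \<open>y $ i\<close>.\<close>
  define P where "P y g = (\<Prod>i\<in>UNIV. w (g i) * (1 + y $ i * f (g i)))"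
    for y :: "real ^ 'k" and g
  define q where "q y = (\<Sum>g\<in>G. P y g * poly_eval p (unblock g))" for y
  \<comment> \<open>\<open>M m i\<close> is the part of the monomial \<open>m\<close> in the
    variables of block \<open>i\<close>, and \<open>e m i\<close> is its degree;
    \<open>\<alpha>\<close> and \<open>\<beta>\<close> are its mean under \<open>w\<close> and its
    correlation with \<open>f\<close>.\<close>
  define M where "M m i x = (\<Prod>j\<in>UNIV. (x $ j) ^ Poly_Mapping.lookup m (i, j))"
    for m :: "'k \<times> 'n \<Rightarrow>\<^sub>0 nat" and i and x :: "real ^ 'n"
  define e where "e m i = (\<Sum>j\<in>UNIV. Poly_Mapping.lookup m (i, j))"
    for m :: "'k \<times> 'n \<Rightarrow>\<^sub>0 nat" and i
  define \<alpha> where "\<alpha> m i = (\<Sum>x\<in>X. w x * M m i x)" for m i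
  define \<beta> where "\<beta> m i = (\<Sum>x\<in>X. w x * (f x * M m i x))" for m i

  \<comment> \<open>Independence of the blocks: the expectation of a product over blocks is the
    product of the expectations.\<close>
  have factor: "(\<Sum>g\<in>G. \<Prod>i\<in>UNIV. h i (g i)) = (\<Prod>i\<in>UNIV. \<Sum>x\<in>X. h i x)"
    for h :: "'k \<Rightarrow> real ^ 'n \<Rightarrow> real"
    unfolding G_def by (subst prod_sum_PiE) (auto simp: X)

  have q_eq: "q y = (\<Sum>m\<in>Poly_Mapping.keys p. Poly_Mapping.lookup p m *
      (\<Prod>i\<in>UNIV. \<alpha> m i + \<beta> m i * y $ i))" for y
  proof -
    have mon: "(\<Prod>ij\<in>UNIV. (unblock g $ ij) ^ Poly_Mapping.lookup m ij) = (\<Prod>i\<in>UNIV. M m i (g i))"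
      for g m
      unfolding M_def unblock_def UNIV_Times_UNIV[symmetric]
      by (simp add: prod.cartesian_product case_prod_beta del: UNIV_Times_UNIV)
    have expand: "(\<Sum>x\<in>X. w x * (1 + y $ i * f x) * M m i x) = \<alpha> m i + \<beta> m i * y $ i" for m i
      unfolding \<alpha>_def \<beta>_def sum_distrib_right sum.distrib[symmetric]
      by (intro sum.cong refl) (simp add: algebra_simps)
    have "q y = (\<Sum>m\<in>Poly_Mapping.keys p. Poly_Mapping.lookup p m *
        (\<Sum>g\<in>G. \<Prod>i\<in>UNIV. w (g i) * (1 + y $ i * f (g i)) * M m i (g i)))"
      unfolding q_def poly_eval_def mon P_def sum_distrib_left
      by (subst sum.swap) (simp add: prod.distrib mult_ac)
    also have "\<dots> = (\<Sum>m\<in>Poly_Mapping.keys p. Poly_Mapping.lookup p m *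
        (\<Prod>i\<in>UNIV. \<Sum>x\<in>X. w x * (1 + y $ i * f x) * M m i x))"
      by (simp add: factor[of "\<lambda>i x. w x * (1 + y $ i * f x) * M _ i x"])
    also have "\<dots> = (\<Sum>m\<in>Poly_Mapping.keys p. Poly_Mapping.lookup p m *
        (\<Prod>i\<in>UNIV. \<alpha> m i + \<beta> m i * y $ i))"
      by (simp only: expand)
    finally show ?thesis .
  qed

  have beta_zero: "\<beta> m i = 0" if "e m i < D" for m i
  proof -
    have "poly_fun (\<Sum>j\<in>UNIV. Poly_Mapping.lookup m (i, j) * 1) (M m i)"
      unfolding M_def by (intro poly_fun_prod poly_fun_power poly_fun_component)
    then show ?thesis using orth[of "e m i"] that by (simp add: e_def \<beta>_def)
  qed

  have "poly_fun (?L div D) q"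
    unfolding q_eq[abs_def]
  proof (intro poly_fun_sum poly_fun_cmult)
    fix m assume m: "m \<in> Poly_Mapping.keys p"
    have "poly_fun (if e m i < D then 0 else 1) (\<lambda>y. \<alpha> m i + \<beta> m i * y $ i)" for i
      by (auto simp: beta_zero intro!: poly_fun_const poly_fun_add poly_fun_cmult
          poly_fun_component[unfolded One_nat_def])
    then have "poly_fun (\<Sum>i\<in>UNIV. if e m i < D then 0 else 1)
        (\<lambda>y. \<Prod>i\<in>UNIV. \<alpha> m i + \<beta> m i * y $ i)"
      by (intro poly_fun_prod)
    \<comment> \<open>Only blocks with \<open>e m i \<ge> D\<close> contribute to the degree in
      \<open>y\<close>, and each uses up at least \<open>D\<close> of the degree of
      \<open>m\<close>. Their number is an integer, so rounding down in \<open>?L div D\<close> is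
      harmless.\<close>
    moreover have "(\<Sum>i\<in>UNIV. if e m i < D then 0 else 1) \<le> ?L div D"
    proof -
      have "(\<Sum>i\<in>UNIV. if e m i < D then 0 else 1) * D \<le> (\<Sum>i\<in>UNIV. e m i)"
        unfolding sum_distrib_right by (intro sum_mono) auto
      also have "\<dots> = (\<Sum>ij\<in>UNIV. Poly_Mapping.lookup m ij)"
        unfolding e_def UNIV_Times_UNIV[symmetric]
        by (simp add: sum.cartesian_product case_prod_beta del: UNIV_Times_UNIV)
      also have "\<dots> \<le> ?L"
        using m p(1) total_degree_le_iff[of p ?L] by simp
      finally show ?thesis using D by (simp add: less_eq_div_iff_mult_less_eq)
    qed
    ultimately show "poly_fun (?L div D) (\<lambda>y. \<Prod>i\<in>UNIV. \<alpha> m i + \<beta> m i * y $ i)"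
      by (rule poly_fun_mono)
  qed
  moreover have "\<bar>F y - q y\<bar> \<le> \<epsilon>" if y: "y \<in> sign_cube" for y
  proof -
    have range: "f (g i) = 1 \<or> f (g i) = -1" "g i \<in> X" if "g \<in> G" for g i
      using that f by (auto simp: G_def PiE_iff Pi_iff)
    have y_range: "y $ i = 1 \<or> y $ i = -1" for i
      using y by (auto simp: sign_cube_def)
    have P_nonneg: "0 \<le> P y g" if "g \<in> G" for g
      unfolding P_def
    proof (intro prod_nonneg ballI mult_nonneg_nonneg)
      fix i
      show "0 \<le> w (g i)" using w(1) range(2)[OF that] by blast
      show "0 \<le> 1 + y $ i * f (g i)" using range(1)[OF that, of i] y_range[of i] by auto
    qed
    have "(\<Sum>x\<in>X. w x * f x) = 0"
      using orth[OF poly_fun_const[of 0 1]] D by simp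
    then have "(\<Sum>x\<in>X. w x * (1 + y $ i * f x)) = 1" for i
      using w(2) by (simp add: distrib_left sum.distrib mult.left_commute[of _ "y $ i"]
          sum_distrib_left[symmetric])
    then have P_sum: "(\<Sum>g\<in>G. P y g) = 1"
      unfolding P_def by (subst factor[of "\<lambda>i x. w x * (1 + y $ i * f x)"]) simp
    \<comment> \<open>A family of nonzero weight has no vanishing factor, so
      \<open>f (g i) = y $ i\<close> for all \<open>i\<close> and the composition takes the value
      \<open>F y\<close> there.\<close>
    have support: "P y g * \<bar>F y - poly_eval p (unblock g)\<bar> \<le> P y g * \<epsilon>" if g: "g \<in> G" for g
    proof (cases "P y g = 0")
      case False
      have "f (g i) = y $ i" for i
      proof -
        have "1 + y $ i * f (g i) \<noteq> 0" using False by (auto simp: P_def)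
        then show ?thesis using range(1)[OF g, of i] y_range[of i] by auto
      qed
      then have "block_compose F f (unblock g) = F y"
        by (simp add: block_compose_def)
      moreover have "unblock g \<in> set_power X"
        using range(2)[OF g] by (simp add: set_power_def)
      ultimately show ?thesis
        using p(2)[of "unblock g"] P_nonneg[OF g] by (simp add: mult_left_mono)
    qed simp
    \<comment> \<open>As the weights sum to 1, the error of \<open>q\<close> at \<open>y\<close> is
      an average of errors of \<open>p\<close>.\<close>
    have "F y - q y = (\<Sum>g\<in>G. P y g * (F y - poly_eval p (unblock g)))"
      by (simp add: q_def right_diff_distrib sum_subtractf sum_distrib_right[symmetric] P_sum)
    also have "\<bar>\<dots>\<bar> \<le> (\<Sum>g\<in>G. \<bar>P y g * (F y - poly_eval p (unblock g))\<bar>)"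
      by (rule sum_abs)
    also have "\<dots> \<le> (\<Sum>g\<in>G. P y g * \<epsilon>)"
      by (intro sum_mono) (use support P_nonneg in \<open>simp add: abs_mult\<close>)
    also have "\<dots> = \<epsilon>"
      by (simp add: sum_distrib_right[symmetric] P_sum)
    finally show ?thesis .
  qed
  ultimately have "approx_degree \<epsilon> sign_cube F \<le> ?L div D"
    by (rule approx_degree_le)
  then show ?thesis using D by (simp add: less_eq_div_iff_mult_less_eq)
qed

theorem theorem1p2:
  fixes X :: "(real ^ 'n::finite) set"
    and f :: "real ^ 'n \<Rightarrow> real"
    and F :: "real ^ 'k::finite \<Rightarrow> real"
    and \<epsilon> :: real
  assumes "finite X"
    and "f \<in> X \<rightarrow> {-1, 1}"
    and "F \<in> sign_cube \<rightarrow> {-1, 1}"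
    and "0 < \<epsilon>" and "\<epsilon> < 1"
  shows "approx_degree \<epsilon> (set_power X) (block_compose F f)
           \<ge> approx_degree \<epsilon> sign_cube F * threshold_degree X f"
proof (cases "threshold_degree X f = 0")
  \<comment> \<open>A threshold degree of 0 makes the right-hand side 0; otherwise even constants
    are orthogonal to \<open>f\<close>, which the conditioning relies on.\<close>
  case False
  then obtain w where "\<And>x. x \<in> X \<Longrightarrow> 0 \<le> w x" "(\<Sum>x\<in>X. w x) = 1"
    "\<And>d g. poly_fun d g \<Longrightarrow> d < threshold_degree X f \<Longrightarrow> (\<Sum>x\<in>X. w x * (f x * g x)) = 0"
    using threshold_degree_dual[OF assms(1)] by blast
  then show ?thesis
    using assms(4) False by (intro approx_degree_compose_ge_of_dual[OF assms(1,2)]) auto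
qed simp

end
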